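(* Let $f \colon \mathbb{R}[X] \to \mathbb{R}[X]$ be an $\mathbb{R}$-linear bijective map preserving the set of polynomials with a real root. Then there are real numbers $a, c \in \mathbb{R}^{\times}$ and $b \in \mathbb{R}$ such that $$\forall P \in \mathbb{R}[X], \quad f(P) = c \cdot P(aX+b).$$ In other words, the set of $\mathbb{R}$-linear bijections $\mathbb{R}[X] \to \mathbb{R}[X]$ preserving the set of polynomials with a real root is equal to $\mathbb{R}^{\times} \rtimes \mathrm{Aut}_{\mathbb{R}\text{-alg}}(\mathbb{R}[X])$, i.e., to the set of maps of the form $P \mapsto c\,\varphi(P)$ with $c \in \mathbb{R}^{\times}$ and $\varphi$ an $\mathbb{R}$-algebra automorphism of $\mathbb{R}[X]$.
   Context: A map $f$ preserves a set $S$ if $f(S) = S$. The zero polynomial has every real number as a root. *)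

theory Defs
  imports "HOL-Computational_Algebra.Computational_Algebra"
begin

text \<open>
  The type \<open>real poly\<close> is not an instance of \<open>real_vector\<close>, so linearity over the reals is
  expressed by the generic locale predicate \<open>Vector_Spaces.linear\<close> with \<open>smult\<close> as
  scalar multiplication on both sides.
\<close>

definition real_linear_bijection :: "(real poly \<Rightarrow> real poly) \<Rightarrow> bool" where
  "real_linear_bijection f \<longleftrightarrow> Vector_Spaces.linear smult smult f \<and> bij f"

text \<open>The zero polynomial belongs to this set.\<close>

definition polys_with_real_root :: "real poly set" where
  "polys_with_real_root = {P. \<exists>x. poly P x = 0}"

definition preserves :: "('a \<Rightarrow> 'a) \<Rightarrow> 'a set \<Rightarrow> bool" where
  "preserves f S \<longleftrightarrow> f ` S = S"

definition real_algebra_automorphism :: "(real poly \<Rightarrow> real poly) \<Rightarrow> bool" where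
  "real_algebra_automorphism \<phi> \<longleftrightarrow>
     real_linear_bijection \<phi> \<and> \<phi> 1 = 1 \<and> (\<forall>P Q. \<phi> (P * Q) = \<phi> P * \<phi> Q)"

end

theory Submission
  imports Defs
begin

text \<open>
  The idea is to trade real roots for the order. A real polynomial without a real root has constant
  sign, so after a change of sign \<open>f 1\<close> is positive everywhere, and then \<open>f\<close> and its inverse both
  preserve the cone of polynomials that are nonnegative on the whole line: if \<open>P\<close> is nonnegative
  while \<open>f P\<close> is negative at \<open>x\<close>, a positive constant \<open>t\<close> can be chosen such that
  \<open>f (P + t)\<close> vanishes at \<open>x\<close>, although \<open>P + t\<close> has no root
  (\<open>nonneg_preserving_of_rootless_preserving\<close>).

  Such an order automorphism sends constants to constants (\<open>order_automorphism_one_constant\<close>): the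
  constants are exactly the polynomials bounded on the line, and a positive polynomial is bounded
  below by a positive constant, so that \<open>\<epsilon> \<le> f 1\<close> bounds the inverse image of \<open>\<epsilon>\<close> by \<open>1\<close>. Dividing by
  this constant gives a unital map \<open>g\<close>.

  Since \<open>(P - s)\<^sup>2\<close> is nonnegative for every constant \<open>s\<close>, a unital positive map satisfies the
  Kadison--Schwarz inequality \<open>(g P)\<^sup>2 \<le> g (P\<^sup>2)\<close>. Using it for the inverse of \<open>g\<close> as well turns
  it into the equality \<open>(g P)\<^sup>2 = g (P\<^sup>2)\<close>, and by polarization \<open>g\<close> is multiplicative
  (\<open>unital_order_automorphism_is_algebra_automorphism\<close>). Finally, an algebra automorphism is the
  substitution of the image of \<open>X\<close>, and surjectivity forces that image to have degree \<open>1\<close>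
  (\<open>algebra_automorphism_affine\<close>).
\<close>

section \<open>Linear bijections and positive maps\<close>

lemma real_linear_bijection_iff:
  "real_linear_bijection f \<longleftrightarrow>
     (\<forall>P Q. f (P + Q) = f P + f Q) \<and> (\<forall>c P. f (smult c P) = smult c (f P)) \<and> bij f"
proof -
  have "vector_space (smult :: real \<Rightarrow> real poly \<Rightarrow> real poly)"
    by unfold_locales (simp_all add: smult_add_right smult_add_left)
  then show ?thesis
    unfolding real_linear_bijection_def Vector_Spaces.linear_iff by simp
qed

lemma
  assumes "real_linear_bijection f"
  shows real_linear_bijection_add: "f (P + Q) = f P + f Q"
    and real_linear_bijection_smult: "f (smult c P) = smult c (f P)"
    and real_linear_bijection_diff: "f (P - Q) = f P - f Q"
    and real_linear_bijection_bij: "bij f"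
proof -
  show add: "f (P + Q) = f P + f Q" for P Q
    using assms by (auto simp: real_linear_bijection_iff)
  show smult: "f (smult c P) = smult c (f P)" for c P
    using assms by (auto simp: real_linear_bijection_iff)
  show "bij f"
    using assms by (auto simp: real_linear_bijection_iff)
  show "f (P - Q) = f P - f Q"
    using add[of P "smult (-1) Q"] smult[of "-1" Q] by simp
qed

lemma real_linear_bijection_inv:
  assumes "real_linear_bijection f"
  shows "real_linear_bijection (inv f)"
proof -
  have b: "bij f"
    using assms by (rule real_linear_bijection_bij)
  have f_inv [simp]: "f (inv f P) = P" for P
    using b by (simp add: bij_is_surj surj_f_inv_f)
  have eqI: "inv f P = Q" if "P = f Q" for P Q
    using b that by (simp add: bij_is_inj)
  show ?thesis
    unfolding real_linear_bijection_iff
  proof (intro conjI allI)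
    show "inv f (P + Q) = inv f P + inv f Q" for P Q
      by (rule eqI) (simp add: real_linear_bijection_add[OF assms])
    show "inv f (smult c P) = smult c (inv f P)" for c P
      by (rule eqI) (simp add: real_linear_bijection_smult[OF assms])
    show "bij (inv f)"
      using b by (rule bij_imp_bij_inv)
  qed
qed

lemma real_linear_bijection_scale:
  assumes "real_linear_bijection f" and "k \<noteq> 0"
  shows "real_linear_bijection (\<lambda>P. smult k (f P))"
proof -
  have "bij (smult k :: real poly \<Rightarrow> real poly)"
    by (rule o_bij[where g = "smult (1 / k)"]) (use \<open>k \<noteq> 0\<close> in \<open>auto simp: fun_eq_iff\<close>)
  then have "bij (smult k \<circ> f)"
    using real_linear_bijection_bij[OF assms(1)] by (intro bij_comp)
  then show ?thesis
    unfolding real_linear_bijection_iff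
    by (simp add: real_linear_bijection_add[OF assms(1)] real_linear_bijection_smult[OF assms(1)]
        smult_add_right mult.commute o_def)
qed

lemma preserves_iff_of_bij:
  assumes "bij f"
  shows "preserves f S \<longleftrightarrow> (\<forall>P. f P \<in> S \<longleftrightarrow> P \<in> S)"
proof
  assume "preserves f S"
  then show "\<forall>P. f P \<in> S \<longleftrightarrow> P \<in> S"
    unfolding preserves_def using assms by (metis bij_is_inj inj_image_mem_iff)
next
  assume iff: "\<forall>P. f P \<in> S \<longleftrightarrow> P \<in> S"
  have "Q \<in> f ` S" if "Q \<in> S" for Q
    using that iff surj_f_inv_f[OF bij_is_surj[OF assms], of Q] by (metis imageI)
  then show "preserves f S"
    unfolding preserves_def using iff by auto
qed

definition nonneg_poly :: "real poly \<Rightarrow> bool" where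
  "nonneg_poly P \<longleftrightarrow> (\<forall>x. 0 \<le> poly P x)"

definition positive_map :: "(real poly \<Rightarrow> real poly) \<Rightarrow> bool" where
  "positive_map f \<longleftrightarrow> (\<forall>P. nonneg_poly P \<longrightarrow> nonneg_poly (f P))"

definition order_automorphism :: "(real poly \<Rightarrow> real poly) \<Rightarrow> bool" where
  "order_automorphism f \<longleftrightarrow>
     real_linear_bijection f \<and> positive_map f \<and> positive_map (inv f)"

lemma positive_mapD: "positive_map f \<Longrightarrow> nonneg_poly P \<Longrightarrow> nonneg_poly (f P)"
  by (simp add: positive_map_def)

lemma order_automorphism_inv: "order_automorphism f \<Longrightarrow> order_automorphism (inv f)"
  by (simp add: order_automorphism_def real_linear_bijection_inv real_linear_bijection_bij
      inv_inv_eq)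

section \<open>From real roots to the order\<close>

lemma rootless_poly_sign:
  fixes P :: "real poly"
  assumes "\<And>x. poly P x \<noteq> 0"
  shows "(\<forall>x. 0 < poly P x) \<or> (\<forall>x. poly P x < 0)"
proof (rule ccontr)
  assume "\<not> ?thesis"
  then obtain x y where "poly P x < 0" "0 < poly P y"
    using assms by (metis linorder_neqE_linordered_idom)
  then show False
    using assms poly_IVT_pos[of x y P] poly_IVT_neg[of y x P]
    by (metis less_irrefl linorder_neqE_linordered_idom order_less_trans)
qed

text \<open>
  If the image of a nonnegative \<open>P\<close> were negative at \<open>x\<close>, adding a suitable positive constant to
  \<open>P\<close> would move a root of the image to \<open>x\<close> while keeping \<open>P\<close> free of roots.
\<close>

lemma nonneg_preserving_of_rootless_preserving:
  assumes f: "real_linear_bijection f"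
    and rootless: "\<And>P x. (\<And>y. poly P y \<noteq> 0) \<Longrightarrow> poly (f P) x \<noteq> 0"
    and one_pos: "\<And>x. 0 < poly (f 1) x"
  shows "positive_map f"
  unfolding positive_map_def nonneg_poly_def
proof (intro allI impI)
  fix P :: "real poly" and x
  assume P: "\<forall>y. 0 \<le> poly P y"
  show "0 \<le> poly (f P) x"
  proof (rule ccontr)
    assume neg: "\<not> 0 \<le> poly (f P) x"
    define t where "t = - poly (f P) x / poly (f 1) x"
    have "0 < t"
      using neg one_pos[of x] by (simp add: t_def divide_neg_pos)
    then have "poly (P + smult t 1) y \<noteq> 0" for y
      using P[rule_format, of y] by simp
    moreover have "poly (f (P + smult t 1)) x = 0"
      using one_pos[of x]
      unfolding real_linear_bijection_add[OF f] real_linear_bijection_smult[OF f]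
      by (simp add: t_def less_imp_neq[symmetric])
    ultimately show False
      using rootless by blast
  qed
qed

lemma order_automorphism_of_preserves:
  assumes f: "real_linear_bijection f"
    and pres: "preserves f polys_with_real_root"
    and one_pos: "\<And>x. 0 < poly (f 1) x"
  shows "order_automorphism f"
proof -
  have b: "bij f"
    using f by (rule real_linear_bijection_bij)
  have f_inv: "f (inv f P) = P" for P
    using b by (simp add: bij_is_surj surj_f_inv_f)
  have root_iff: "(\<exists>x. poly (f P) x = 0) \<longleftrightarrow> (\<exists>x. poly P x = 0)" for P
    using pres preserves_iff_of_bij[OF b] by (simp add: polys_with_real_root_def)
  have pos: "positive_map f"
    using f _ one_pos by (rule nonneg_preserving_of_rootless_preserving) (use root_iff in blast)
  have inv_rootless: "poly (inv f P) x \<noteq> 0" if "\<And>y. poly P y \<noteq> 0" for P x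
    using that root_iff[of "inv f P"] by (auto simp: f_inv)
  \<comment> \<open>The other sign is impossible: positivity of \<open>f\<close> would make \<open>f (- inv f 1) = - 1\<close> nonnegative.\<close>
  have inv_one_pos: "0 < poly (inv f 1) x" for x
  proof (rule ccontr)
    assume "\<not> 0 < poly (inv f 1) x"
    then have "\<forall>y. poly (inv f 1) y < 0"
      using rootless_poly_sign[of "inv f 1"] inv_rootless[of 1] by auto
    then have "nonneg_poly (smult (-1) (inv f 1))"
      by (simp add: nonneg_poly_def less_imp_le)
    then have "nonneg_poly (f (smult (-1) (inv f 1)))"
      by (rule positive_mapD[OF pos])
    then show False
      unfolding real_linear_bijection_smult[OF f] f_inv by (simp add: nonneg_poly_def)
  qed
  have "positive_map (inv f)"
    using real_linear_bijection_inv[OF f] inv_rootless inv_one_pos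
    by (rule nonneg_preserving_of_rootless_preserving)
  then show ?thesis
    using f pos by (simp add: order_automorphism_def)
qed

section \<open>Order automorphisms fix the line of constants\<close>

lemma bounded_poly_constant:
  fixes P :: "real poly"
  assumes "\<And>x. \<bar>poly P x\<bar> \<le> K"
  shows "\<exists>a. P = [:a:]"
proof -
  obtain a Q where P: "P = pCons a Q"
    by (cases P)
  have "Q = 0"
  proof (rule ccontr)
    assume "Q \<noteq> 0"
    then obtain r where "\<And>x. r \<le> norm x \<Longrightarrow> K + 1 \<le> norm (poly (pCons a Q) x)"
      using poly_infinity by blast
    from this[of "\<bar>r\<bar>"] show False
      using assms[of "\<bar>r\<bar>"] P by (simp add: abs_ge_self)
  qed
  then show ?thesis
    using P by blast
qed

text \<open>
  The analytic input: outside a compact interval the modulus of a nonconstant polynomial is at least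
  its value at \<open>0\<close>, and on the interval it attains its minimum.
\<close>

lemma positive_poly_bounded_below:
  fixes P :: "real poly"
  assumes pos: "\<And>x. 0 < poly P x"
  shows "\<exists>\<epsilon>>0. \<forall>x. \<epsilon> \<le> poly P x"
proof -
  obtain a Q where P: "P = pCons a Q"
    by (cases P)
  show ?thesis
  proof (cases "Q = 0")
    case True
    then show ?thesis
      using pos[of 0] P by auto
  next
    case False
    then obtain r where r: "\<And>x. r \<le> norm x \<Longrightarrow> poly P 0 \<le> norm (poly P x)"
      using poly_infinity P by metis
    obtain m where m: "\<And>x. - \<bar>r\<bar> \<le> x \<and> x \<le> \<bar>r\<bar> \<Longrightarrow> m \<le> poly P x" and "\<exists>x. poly P x = m"
      using isCont_eq_Lb[of "- \<bar>r\<bar>" "\<bar>r\<bar>" "poly P"] by auto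
    then have "0 < m"
      using pos by auto
    moreover have "min m (poly P 0) \<le> poly P x" for x
    proof (cases "\<bar>x\<bar> \<le> \<bar>r\<bar>")
      case True
      then show ?thesis
        using m[of x] by (simp add: abs_le_iff min_le_iff_disj)
    next
      case False
      then show ?thesis
        using r[of x] pos[of x] by (simp add: min_le_iff_disj)
    qed
    ultimately show ?thesis
      using pos[of 0] by (intro exI[of _ "min m (poly P 0)"]) auto
  qed
qed

text \<open>
  With \<open>0 < \<epsilon> \<le> f 1\<close>, applying the inverse gives \<open>0 \<le> inv f \<epsilon> \<le> 1\<close>. Hence \<open>inv f 1\<close> is bounded,
  so it is a constant, and \<open>f\<close> maps this constant to \<open>1\<close>.
\<close>

lemma order_automorphism_one_constant:
  assumes f: "order_automorphism f" and one_pos: "\<And>x. 0 < poly (f 1) x"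
  shows "\<exists>c>0. f 1 = [:c:]"
proof -
  have lin: "real_linear_bijection f" and pos: "positive_map (inv f)"
    using f by (auto simp: order_automorphism_def)
  note lin_inv = real_linear_bijection_inv[OF lin]
  have b: "bij f"
    using lin by (rule real_linear_bijection_bij)
  obtain \<epsilon> where "\<epsilon> > 0" and \<epsilon>: "\<And>x. \<epsilon> \<le> poly (f 1) x"
    using positive_poly_bounded_below[OF one_pos] by blast
  have "nonneg_poly (inv f (f 1 - smult \<epsilon> 1))"
    by (rule positive_mapD[OF pos]) (simp add: nonneg_poly_def \<epsilon>)
  moreover have "inv f (f 1 - smult \<epsilon> 1) = 1 - smult \<epsilon> (inv f 1)"
    using b by (simp add: real_linear_bijection_diff[OF lin_inv]
        real_linear_bijection_smult[OF lin_inv] bij_is_inj del: smult_one)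
  ultimately have "nonneg_poly (1 - smult \<epsilon> (inv f 1))"
    by metis
  then have "poly (inv f 1) x \<le> 1 / \<epsilon>" for x
    using \<open>\<epsilon> > 0\<close> by (simp add: nonneg_poly_def field_simps)
  moreover have "nonneg_poly (inv f 1)"
    by (rule positive_mapD[OF pos]) (simp add: nonneg_poly_def)
  ultimately obtain k where "inv f 1 = [:k:]"
    using bounded_poly_constant[of "inv f 1" "1 / \<epsilon>"] by (auto simp: nonneg_poly_def)
  then have "f (smult k 1) = 1"
    using b by (metis bij_is_surj smult_one surj_f_inv_f)
  then have k: "smult k (f 1) = 1"
    by (simp add: real_linear_bijection_smult[OF lin] del: smult_one)
  then have "k \<noteq> 0"
    by auto
  have "f 1 = smult (1 / k) (smult k (f 1))"
    using \<open>k \<noteq> 0\<close> by simp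
  also have "\<dots> = [:1 / k:]"
    by (simp add: k)
  finally show ?thesis
    using one_pos[of 0] by auto
qed

section \<open>Unital order automorphisms are multiplicative\<close>

text \<open>
  The commutative Kadison--Schwarz inequality at the point \<open>x\<close>: apply \<open>f\<close> to \<open>(P - s)\<^sup>2\<close>, where the
  best constant is \<open>s = poly (f P) x\<close>.
\<close>

lemma kadison_schwarz:
  assumes lin: "real_linear_bijection f" and pos: "positive_map f" and one: "f 1 = 1"
  shows "nonneg_poly (f (P * P) - f P * f P)"
  unfolding nonneg_poly_def
proof
  fix x
  define s where "s = poly (f P) x"
  have expand: "(P - smult s 1) * (P - smult s 1) = P * P - smult (2 * s) P + smult (s * s) 1"
    by (simp add: poly_eq_poly_eq_iff[symmetric] fun_eq_iff algebra_simps)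
  have "nonneg_poly (f ((P - smult s 1) * (P - smult s 1)))"
    by (rule positive_mapD[OF pos]) (simp add: nonneg_poly_def)
  then have "0 \<le> poly (f (P * P)) x - 2 * s * poly (f P) x + s * s"
    unfolding expand real_linear_bijection_add[OF lin] real_linear_bijection_diff[OF lin]
      real_linear_bijection_smult[OF lin] one
    by (simp add: nonneg_poly_def)
  then show "0 \<le> poly (f (P * P) - f P * f P) x"
    by (simp add: s_def)
qed

lemma unital_order_automorphism_square:
  assumes f: "order_automorphism f" and one: "f 1 = 1"
  shows "f (P * P) = f P * f P"
proof -
  have lin: "real_linear_bijection f" and pos: "positive_map f" "positive_map (inv f)"
    using f by (auto simp: order_automorphism_def)
  have b: "bij f"
    using lin by (rule real_linear_bijection_bij)
  then have inv_f [simp]: "inv f (f Q) = Q" and f_inv [simp]: "f (inv f Q) = Q" for Q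
    by (simp_all add: bij_is_inj bij_is_surj surj_f_inv_f)
  have "inv f 1 = 1"
    by (metis one inv_f)
  \<comment> \<open>Kadison--Schwarz for the inverse at \<open>f P\<close>, transported back by \<open>f\<close>, is the reverse inequality.\<close>
  then have "nonneg_poly (inv f (f P * f P) - P * P)"
    using kadison_schwarz[OF real_linear_bijection_inv[OF lin] pos(2), of "f P"] by simp
  then have "nonneg_poly (f (inv f (f P * f P) - P * P))"
    by (rule positive_mapD[OF pos(1)])
  then have "nonneg_poly (f P * f P - f (P * P))"
    by (simp add: real_linear_bijection_diff[OF lin])
  moreover have "nonneg_poly (f (P * P) - f P * f P)"
    using lin pos(1) one by (rule kadison_schwarz)
  ultimately have "poly (f (P * P)) x = poly (f P * f P) x" for x
    by (simp add: nonneg_poly_def order.eq_iff)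
  then show ?thesis
    by (simp add: poly_eq_poly_eq_iff[symmetric] fun_eq_iff)
qed

lemma unital_order_automorphism_is_algebra_automorphism:
  assumes f: "order_automorphism f" and one: "f 1 = 1"
  shows "real_algebra_automorphism f"
proof -
  have lin: "real_linear_bijection f"
    using f by (simp add: order_automorphism_def)
  note sq = unital_order_automorphism_square[OF assms]
  have "f (P * Q) = f P * f Q" for P Q
  proof -
    have "(P + Q) * (P + Q) = P * P + smult 2 (P * Q) + Q * Q"
      by (simp add: poly_eq_poly_eq_iff[symmetric] fun_eq_iff algebra_simps)
    then have "f ((P + Q) * (P + Q)) = f P * f P + smult 2 (f (P * Q)) + f Q * f Q"
      by (simp add: real_linear_bijection_add[OF lin] real_linear_bijection_smult[OF lin] sq)
    moreover have "f ((P + Q) * (P + Q)) = f P * f P + smult 2 (f P * f Q) + f Q * f Q"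
      unfolding sq real_linear_bijection_add[OF lin] by (simp add: poly_eq_poly_eq_iff[symmetric] fun_eq_iff algebra_simps)
    ultimately have "smult 2 (f (P * Q)) = smult 2 (f P * f Q)"
      by simp
    then show ?thesis
      by (simp add: smult_eq_iff)
  qed
  then show ?thesis
    using lin one by (simp add: real_algebra_automorphism_def)
qed

section \<open>The classification\<close>

text \<open>
  The sign of \<open>f 1\<close> is undetermined, so the order argument is applied to \<open>f\<close> or to \<open>- f\<close>
  to see that \<open>f 1\<close> is a constant, and once more to \<open>f\<close> divided by this constant.
\<close>

lemma preserves_imp_scaled_automorphism:
  assumes f: "real_linear_bijection f" and pres: "preserves f polys_with_real_root"
  shows "\<exists>c \<phi>. c \<noteq> 0 \<and> real_algebra_automorphism \<phi> \<and> f = (\<lambda>P. smult c (\<phi> P))"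
proof -
  have root_iff: "(\<exists>x. poly (f P) x = 0) \<longleftrightarrow> (\<exists>x. poly P x = 0)" for P
    using pres preserves_iff_of_bij[OF real_linear_bijection_bij[OF f]]
    by (simp add: polys_with_real_root_def)
  have scaled: "preserves (\<lambda>P. smult k (f P)) polys_with_real_root" if "k \<noteq> 0" for k
    using that root_iff
      preserves_iff_of_bij[OF real_linear_bijection_bij[OF real_linear_bijection_scale[OF f that]]]
    by (simp add: polys_with_real_root_def)
  have "\<And>x. poly (f 1) x \<noteq> 0"
    using root_iff[of 1] by simp
  from rootless_poly_sign[OF this] obtain u :: real
    where "u \<noteq> 0" and one_pos: "\<And>x. 0 < poly (smult u (f 1)) x"
  proof
    assume "\<forall>x. 0 < poly (f 1) x"
    then show thesis
      using that[of 1] by simp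
  next
    assume "\<forall>x. poly (f 1) x < 0"
    then show thesis
      using that[of "-1"] by simp
  qed
  have "order_automorphism (\<lambda>P. smult u (f P))"
    using real_linear_bijection_scale[OF f \<open>u \<noteq> 0\<close>] scaled[OF \<open>u \<noteq> 0\<close>] one_pos
    by (rule order_automorphism_of_preserves)
  then obtain c where "c > 0" and c: "smult u (f 1) = [:c:]"
    using order_automorphism_one_constant one_pos by blast
  define k where "k = u / c"
  have "k \<noteq> 0"
    using \<open>u \<noteq> 0\<close> \<open>c > 0\<close> by (simp add: k_def)
  define \<phi> where "\<phi> = (\<lambda>P. smult k (f P))"
  have "\<phi> 1 = smult (1 / c) (smult u (f 1))"
    by (simp add: \<phi>_def k_def)
  then have one: "\<phi> 1 = 1"
    using \<open>c > 0\<close> unfolding c by (simp add: one_pCons)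
  have "order_automorphism \<phi>"
  proof (rule order_automorphism_of_preserves)
    show "real_linear_bijection \<phi>"
      unfolding \<phi>_def using f \<open>k \<noteq> 0\<close> by (rule real_linear_bijection_scale)
    show "preserves \<phi> polys_with_real_root"
      unfolding \<phi>_def using \<open>k \<noteq> 0\<close> by (rule scaled)
    show "0 < poly (\<phi> 1) x" for x
      by (simp add: one)
  qed
  then have "real_algebra_automorphism \<phi>"
    using one by (rule unital_order_automorphism_is_algebra_automorphism)
  moreover have "f = (\<lambda>P. smult (1 / k) (\<phi> P))"
    using \<open>k \<noteq> 0\<close> by (simp add: \<phi>_def)
  ultimately show ?thesis
    using \<open>k \<noteq> 0\<close> by (metis divide_eq_0_iff one_neq_zero)
qed

text \<open>
  An algebra endomorphism is determined by the image \<open>q\<close> of \<open>X\<close>; that \<open>X\<close> itself is some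
  \<open>P \<circ>\<^sub>p q\<close> forces \<open>deg P * deg q = 1\<close>.
\<close>

lemma algebra_automorphism_affine:
  assumes "real_algebra_automorphism \<phi>"
  shows "\<exists>a b. a \<noteq> 0 \<and> (\<forall>P. \<phi> P = pcompose P [:b, a:])"
proof -
  have lin: "real_linear_bijection \<phi>" and one: "\<phi> 1 = 1"
    and mult: "\<And>P Q. \<phi> (P * Q) = \<phi> P * \<phi> Q"
    using assms by (auto simp: real_algebra_automorphism_def)
  define q where "q = \<phi> [:0, 1:]"
  have subst: "\<phi> P = pcompose P q" for P
  proof (induction P)
    case 0
    show ?case
      using real_linear_bijection_smult[OF lin, of 0 0] by simp
  next
    case (pCons a P)
    have "pCons a P = smult a 1 + [:0, 1:] * P"
      by simp
    then have "\<phi> (pCons a P) = smult a 1 + q * \<phi> P"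
      by (metis real_linear_bijection_add[OF lin] real_linear_bijection_smult[OF lin] one mult q_def)
    then show ?case
      using pCons.IH by (simp add: pcompose_pCons)
  qed
  obtain P where "\<phi> P = [:0, 1:]"
    using real_linear_bijection_bij[OF lin] by (metis bij_is_surj surjD)
  then have "degree P * degree q = 1"
    by (metis subst degree_pcompose degree_pCons_eq_if one_neq_zero pCons_eq_0_iff degree_pCons_0 One_nat_def)
  then have deg: "degree q = 1"
    by simp
  then obtain a b where q: "q = [:b, a:]"
    by (metis degree1_coeffs)
  then have "a \<noteq> 0"
    using deg by auto
  then show ?thesis
    using subst q by blast
qed

lemma scaled_automorphism_preserves:
  assumes "c \<noteq> 0" and \<phi>: "real_algebra_automorphism \<phi>"
  shows "real_linear_bijection (\<lambda>P. smult c (\<phi> P))"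
    and "preserves (\<lambda>P. smult c (\<phi> P)) polys_with_real_root"
proof -
  show lin: "real_linear_bijection (\<lambda>P. smult c (\<phi> P))"
    using \<phi> \<open>c \<noteq> 0\<close> by (simp add: real_linear_bijection_scale real_algebra_automorphism_def)
  obtain a b where "a \<noteq> 0" and \<phi>_eq: "\<And>P. \<phi> P = pcompose P [:b, a:]"
    using algebra_automorphism_affine[OF \<phi>] by blast
  have "(\<exists>x. poly (pcompose P [:b, a:]) x = 0) \<longleftrightarrow> (\<exists>x. poly P x = 0)" for P
  proof
    assume "\<exists>x. poly P x = 0"
    then obtain x where "poly P x = 0" ..
    then have "poly (pcompose P [:b, a:]) ((x - b) / a) = 0"
      using \<open>a \<noteq> 0\<close> by (simp add: poly_pcompose)
    then show "\<exists>x. poly (pcompose P [:b, a:]) x = 0" ..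
  qed (auto simp: poly_pcompose)
  then show "preserves (\<lambda>P. smult c (\<phi> P)) polys_with_real_root"
    using \<open>c \<noteq> 0\<close> unfolding preserves_iff_of_bij[OF real_linear_bijection_bij[OF lin]]
    by (simp add: polys_with_real_root_def \<phi>_eq)
qed

theorem theorem5p1:
  shows "(\<forall>f :: real poly \<Rightarrow> real poly.
            real_linear_bijection f \<and> preserves f polys_with_real_root \<longrightarrow>
            (\<exists>a b c :: real. a \<noteq> 0 \<and> c \<noteq> 0 \<and>
               (\<forall>P. f P = smult c (pcompose P [:b, a:]))))
       \<and> {f :: real poly \<Rightarrow> real poly.
            real_linear_bijection f \<and> preserves f polys_with_real_root}
         = {f. \<exists>(c :: real) \<phi>. c \<noteq> 0 \<and> real_algebra_automorphism \<phi> \<and>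
               f = (\<lambda>P. smult c (\<phi> P))}"
proof (intro conjI allI impI)
  fix f :: "real poly \<Rightarrow> real poly"
  assume "real_linear_bijection f \<and> preserves f polys_with_real_root"
  then obtain c \<phi> where "c \<noteq> 0" "real_algebra_automorphism \<phi>" "f = (\<lambda>P. smult c (\<phi> P))"
    using preserves_imp_scaled_automorphism by blast
  then show "\<exists>a b c :: real. a \<noteq> 0 \<and> c \<noteq> 0 \<and> (\<forall>P. f P = smult c (pcompose P [:b, a:]))"
    using algebra_automorphism_affine by metis
next
  show "{f :: real poly \<Rightarrow> real poly.
            real_linear_bijection f \<and> preserves f polys_with_real_root}
         = {f. \<exists>(c :: real) \<phi>. c \<noteq> 0 \<and> real_algebra_automorphism \<phi> \<and>
               f = (\<lambda>P. smult c (\<phi> P))}"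
    using preserves_imp_scaled_automorphism scaled_automorphism_preserves by blast
qed

end
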